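(* Let $n\ge 1$, let $I=\{1,2,\dots,n\}$, let $\mathcal I_{\text{odd}}$ (respectively $\mathcal I_{\text{even}}$) be the collection of all subsets of $I$ having an odd (respectively even) number of elements, with $\emptyset\in\mathcal I_{\text{even}}$. Suppose $\alpha_i\ge\beta_i\ge 0$ for $i=1,\dots,n$. Then the function $$U(x)=\frac{\prod_{J\in\mathcal I_{\text{even}}}\Gamma\left(x+\sum_{i\in J}\alpha_i+\sum_{i\in I\setminus J}\beta_i\right)}{\prod_{J\in\mathcal I_{\text{odd}}}\Gamma\left(x+\sum_{i\in J}\alpha_i+\sum_{i\in I\setminus J}\beta_i\right)}$$ is logarithmically completely monotonic on $(0,\infty)$.
   Context: A nonnegative function $f$ on $(0,\infty)$ is completely monotonic if it has derivatives of all orders and $(-1)^nf^{(n)}(x)\ge 0$ for all $n\ge 1$, $x>0$. A positive function $f$ on $(0,\infty)$ is logarithmically completely monotonic if $-(\log f)'$ is completely monotonic on $(0,\infty)$. $\Gamma$ is Euler's gamma function. *)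

theory Defs
  imports "HOL-Analysis.Analysis"
begin

text \<open>
  The functions live on the open half-line \<open>(0, \<infinity>)\<close>; values at \<open>x \<le> 0\<close> are irrelevant,
  since derivatives at a positive point are local. As \<^const>\<open>deriv\<close> is total,
  differentiability has to be demanded explicitly.
\<close>

definition completely_monotonic :: "(real \<Rightarrow> real) \<Rightarrow> bool" where
  "completely_monotonic f \<longleftrightarrow>
     (\<forall>x>0. f x \<ge> 0) \<and>
     (\<forall>n. \<forall>x>0. (deriv ^^ n) f differentiable (at x)) \<and>
     (\<forall>n\<ge>1. \<forall>x>0. (-1) ^ n * (deriv ^^ n) f x \<ge> 0)"

definition logarithmically_completely_monotonic :: "(real \<Rightarrow> real) \<Rightarrow> bool" where
  "logarithmically_completely_monotonic f \<longleftrightarrow>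
     (\<forall>x>0. f x > 0) \<and>
     (\<forall>x>0. (\<lambda>y. ln (f y)) differentiable (at x)) \<and>
     completely_monotonic (\<lambda>x. - deriv (\<lambda>y. ln (f y)) x)"

text \<open>Intended for finite \<open>I\<close>, as an infinite set has \<^const>\<open>card\<close> 0.\<close>

definition even_subsets :: "'a set \<Rightarrow> 'a set set" where
  "even_subsets I = {J. J \<subseteq> I \<and> even (card J)}"

definition odd_subsets :: "'a set \<Rightarrow> 'a set set" where
  "odd_subsets I = {J. J \<subseteq> I \<and> odd (card J)}"

end

theory Submission
  imports Defs
begin

text \<open>
  Let \<open>\<Delta>\<^sub>i g (x) = g (x + \<beta>\<^sub>i) - g (x + \<alpha>\<^sub>i)\<close>. Expanding the composition of the commuting operators
  \<open>\<Delta>\<^sub>i\<close> over \<open>i \<in> I\<close> produces exactly the sum over subsets \<open>J\<close> of \<open>I\<close> with sign \<open>(-1) ^ card J\<close> and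
  shift \<open>\<Sum>\<^bsub>J\<^esub> \<alpha> + \<Sum>\<^bsub>I - J\<^esub> \<beta>\<close>, so the logarithm of the quotient in the theorem is this composition
  applied to \<open>ln \<Gamma>\<close>, and minus its logarithmic derivative is the composition applied to \<open>- \<psi>\<close>,
  where \<open>\<psi>\<close> is the digamma function.

  The function \<open>g = - \<psi>\<close> is not completely monotonic, because it becomes negative, but it has the
  right signs \<open>(-1) ^ k * g\<^sup>(\<^sup>k\<^sup>) \<ge> 0\<close> for all \<open>k \<ge> 1\<close>. For any such \<open>g\<close> the functions
  \<open>(-1) ^ k * g\<^sup>(\<^sup>k\<^sup>)\<close> are nonincreasing for all \<open>k \<ge> 0\<close>, and since \<open>0 \<le> \<beta>\<^sub>i \<le> \<alpha>\<^sub>i\<close> the difference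
  \<open>\<Delta>\<^sub>i g\<close> has the right signs for all \<open>k \<ge> 0\<close>, including \<open>k = 0\<close>. Hence one difference
  turns \<open>g\<close> into a completely monotonic function, and further differences keep it completely
  monotonic (\<open>mixed_difference_sign\<close>). This replaces the usual argument through the integral
  representation of \<open>\<psi>\<close>.
\<close>

definition mixed_difference ::
  "'a set \<Rightarrow> ('a \<Rightarrow> real) \<Rightarrow> ('a \<Rightarrow> real) \<Rightarrow> (real \<Rightarrow> real) \<Rightarrow> real \<Rightarrow> real" where
  "mixed_difference I \<alpha> \<beta> g x =
     (\<Sum>J\<in>Pow I. (-1) ^ card J * g (x + (\<Sum>i\<in>J. \<alpha> i) + (\<Sum>i\<in>I - J. \<beta> i)))"

text \<open>
  The recursion that makes induction on \<open>I\<close> possible: the subsets of \<open>insert i I\<close> without \<open>i\<close>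
  receive the additional shift \<open>\<beta> i\<close>, those containing \<open>i\<close> the shift \<open>\<alpha> i\<close> and a change of sign.
\<close>

lemma mixed_difference_insert:
  assumes "finite I" and "i \<notin> I"
  shows "mixed_difference (insert i I) \<alpha> \<beta> g x =
    mixed_difference I \<alpha> \<beta> g (x + \<beta> i) - mixed_difference I \<alpha> \<beta> g (x + \<alpha> i)"
proof -
  let ?t = "\<lambda>J. (-1) ^ card J * g (x + (\<Sum>j\<in>J. \<alpha> j) + (\<Sum>j\<in>insert i I - J. \<beta> j))"
  have without: "?t J =
      (-1) ^ card J * g ((x + \<beta> i) + (\<Sum>j\<in>J. \<alpha> j) + (\<Sum>j\<in>I - J. \<beta> j))"
    if "J \<in> Pow I" for J
  proof -
    have "insert i I - J = insert i (I - J)" using that assms(2) by auto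
    then show ?thesis using assms by (simp add: add_ac)
  qed
  have contains: "?t (insert i J) =
      - ((-1) ^ card J * g ((x + \<alpha> i) + (\<Sum>j\<in>J. \<alpha> j) + (\<Sum>j\<in>I - J. \<beta> j)))"
    if "J \<in> Pow I" for J
  proof -
    have "insert i I - insert i J = I - J" "i \<notin> J" "finite J"
      using that assms finite_subset by auto
    then show ?thesis by (simp add: add_ac)
  qed
  have disj: "Pow I \<inter> insert i ` Pow I = {}" using assms(2) by auto
  have inj: "inj_on (insert i) (Pow I)" using assms(2) by (auto simp: inj_on_def)
  have "mixed_difference (insert i I) \<alpha> \<beta> g x = (\<Sum>J\<in>Pow I. ?t J) + (\<Sum>J\<in>insert i ` Pow I. ?t J)"
    unfolding mixed_difference_def Pow_insert
    by (rule sum.union_disjoint) (use assms(1) disj in auto)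
  also have "(\<Sum>J\<in>insert i ` Pow I. ?t J) = (\<Sum>J\<in>Pow I. ?t (insert i J))"
    by (simp add: sum.reindex[OF inj])
  finally show ?thesis
    unfolding mixed_difference_def using without contains by (simp add: sum_negf)
qed

lemma has_derivative_mixed_difference:
  assumes "\<And>y. y > 0 \<Longrightarrow> (g has_real_derivative g' y) (at y)"
    and "\<And>i. i \<in> I \<Longrightarrow> \<alpha> i \<ge> 0" and "\<And>i. i \<in> I \<Longrightarrow> \<beta> i \<ge> 0" and "x > 0"
  shows "(mixed_difference I \<alpha> \<beta> g has_real_derivative mixed_difference I \<alpha> \<beta> g' x) (at x)"
proof -
  have "((\<lambda>y. g (y + (\<Sum>i\<in>J. \<alpha> i) + (\<Sum>i\<in>I - J. \<beta> i))) has_real_derivative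
      g' (x + (\<Sum>i\<in>J. \<alpha> i) + (\<Sum>i\<in>I - J. \<beta> i))) (at x)" if "J \<in> Pow I" for J
  proof -
    have "(\<Sum>i\<in>J. \<alpha> i) \<ge> 0" "(\<Sum>i\<in>I - J. \<beta> i) \<ge> 0"
      using that assms(2,3) by (auto intro!: sum_nonneg)
    with assms(4) have "x + (\<Sum>i\<in>J. \<alpha> i) + (\<Sum>i\<in>I - J. \<beta> i) > 0" by linarith
    from assms(1)[OF this] show ?thesis
      unfolding add.assoc DERIV_shift .
  qed
  then show ?thesis
    unfolding mixed_difference_def[abs_def] by (intro DERIV_sum DERIV_cmult) auto
qed

text \<open>
  The disjunction \<open>k \<ge> 1 \<or> I \<noteq> {}\<close> records that the sign at order \<open>0\<close> appears only after a first
  difference has been taken. It makes the induction uniform: the step at order \<open>k\<close> consults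
  order \<open>Suc k\<close> for the smaller set, where the disjunction holds even if that set is empty.
\<close>

lemma mixed_difference_sign:
  fixes G :: "nat \<Rightarrow> real \<Rightarrow> real"
  assumes deriv: "\<And>k x. x > 0 \<Longrightarrow> (G k has_real_derivative G (Suc k) x) (at x)"
    and sign: "\<And>k x. k \<ge> 1 \<Longrightarrow> x > 0 \<Longrightarrow> (-1) ^ k * G k x \<ge> 0"
    and "finite I"
    and "\<And>i. i \<in> I \<Longrightarrow> \<alpha> i \<ge> \<beta> i" and "\<And>i. i \<in> I \<Longrightarrow> \<beta> i \<ge> 0"
    and "x > 0" and "k \<ge> 1 \<or> I \<noteq> {}"
  shows "(-1) ^ k * mixed_difference I \<alpha> \<beta> (G k) x \<ge> 0"
  using assms(3-)
proof (induction I arbitrary: x k rule: finite_induct)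
  case empty
  then show ?case using sign by (simp add: mixed_difference_def)
next
  case (insert i I)
  let ?F = "\<lambda>k. mixed_difference I \<alpha> \<beta> (G k)"
  have nonneg: "\<beta> i \<ge> 0" "\<alpha> i \<ge> \<beta> i" using insert.prems by auto
  have dF: "(?F k has_real_derivative ?F (Suc k) y) (at y)" if "y > 0" for y
  proof (rule has_derivative_mixed_difference[OF deriv _ _ that])
    show "\<alpha> j \<ge> 0" if "j \<in> I" for j
      using insert.prems(1,2)[of j] that by auto
    show "\<beta> j \<ge> 0" if "j \<in> I" for j
      using insert.prems(2)[of j] that by auto
  qed
  have "(-1) ^ k * ?F k (x + \<beta> i) \<ge> (-1) ^ k * ?F k (x + \<alpha> i)"
  proof (rule DERIV_nonpos_imp_nonincreasing[where f = "\<lambda>y. (-1) ^ k * ?F k y"])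
    show "x + \<beta> i \<le> x + \<alpha> i" using nonneg by simp
    fix y assume "x + \<beta> i \<le> y" "y \<le> x + \<alpha> i"
    then have "y > 0" using nonneg insert.prems(3) by linarith
    have "(-1) ^ Suc k * ?F (Suc k) y \<ge> 0"
      by (rule insert.IH) (use insert.prems \<open>y > 0\<close> in auto)
    then have "(-1) ^ k * ?F (Suc k) y \<le> 0" by simp
    with DERIV_cmult[OF dF[OF \<open>y > 0\<close>]]
    show "\<exists>d. ((\<lambda>y. (-1) ^ k * ?F k y) has_real_derivative d) (at y) \<and> d \<le> 0"
      by blast
  qed
  then show ?case
    using insert.hyps by (simp add: mixed_difference_insert algebra_simps)
qed

lemma Polygamma_real_alternating_sign:
  assumes "k \<ge> 1" and "(x::real) > 0"
  shows "(-1) ^ k * - Polygamma k x \<ge> 0"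
proof (cases "even k")
  case True
  then show ?thesis using Polygamma_real_even_neg[of x k] assms by simp
next
  case False
  have "x \<notin> \<int>\<^sub>\<le>\<^sub>0" using assms(2) by (auto elim!: nonpos_Ints_cases)
  then show ?thesis using False Polygamma_real_odd_pos[of x k] by simp
qed

text \<open>
  Iterated derivatives at a positive point depend only on values nearby, so complete monotonicity
  of \<open>f\<close> can be read off from any family that agrees with \<open>f\<close> and its derivatives on the positive
  half-line, whatever \<open>f\<close> does elsewhere.
\<close>

lemma completely_monotonic_if_derivative_family:
  fixes F :: "nat \<Rightarrow> real \<Rightarrow> real"
  assumes eq: "\<And>x. x > 0 \<Longrightarrow> f x = F 0 x"
    and deriv: "\<And>k x. x > 0 \<Longrightarrow> (F k has_real_derivative F (Suc k) x) (at x)"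
    and sign: "\<And>k x. x > 0 \<Longrightarrow> (-1) ^ k * F k x \<ge> 0"
  shows "completely_monotonic f"
proof -
  have near: "\<forall>\<^sub>F y in nhds x. y > 0" if "x > 0" for x :: real
    using eventually_nhds_in_open[of "{0<..}" x] that by simp
  have iter: "(deriv ^^ k) f x = F k x" if "x > 0" for k x
    using that
  proof (induction k arbitrary: x)
    case 0
    then show ?case using eq by simp
  next
    case (Suc k)
    have "\<forall>\<^sub>F y in nhds x. (deriv ^^ k) f y = F k y"
      using near[OF Suc.prems] by eventually_elim (rule Suc.IH)
    then have "deriv ((deriv ^^ k) f) x = deriv (F k) x"
      by (intro deriv_cong_ev refl)
    then show ?case using DERIV_imp_deriv[OF deriv[OF Suc.prems]] by simp
  qed
  have "(deriv ^^ k) f differentiable (at x)" if "x > 0" for k x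
  proof -
    have "\<forall>\<^sub>F y in nhds x. (deriv ^^ k) f y = F k y"
      using near[OF that] by eventually_elim (rule iter)
    from DERIV_cong_ev[OF refl this refl] deriv[OF that]
    have "((deriv ^^ k) f has_real_derivative F (Suc k) x) (at x)" by (rule iffD2)
    then show ?thesis by (auto simp: real_differentiable_def)
  qed
  then show ?thesis
    unfolding completely_monotonic_def using iter sign eq sign[of _ 0] by auto
qed

lemma ln_even_odd_quotient_eq_mixed_difference:
  fixes g :: "real \<Rightarrow> real"
  assumes "finite I"
    and pos: "\<And>J. J \<subseteq> I \<Longrightarrow> g (x + (\<Sum>i\<in>J. \<alpha> i) + (\<Sum>i\<in>I - J. \<beta> i)) > 0"
  shows "ln ((\<Prod>J\<in>even_subsets I. g (x + (\<Sum>i\<in>J. \<alpha> i) + (\<Sum>i\<in>I - J. \<beta> i))) /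
      (\<Prod>J\<in>odd_subsets I. g (x + (\<Sum>i\<in>J. \<alpha> i) + (\<Sum>i\<in>I - J. \<beta> i)))) =
    mixed_difference I \<alpha> \<beta> (\<lambda>y. ln (g y)) x"
proof -
  let ?g = "\<lambda>J. g (x + (\<Sum>i\<in>J. \<alpha> i) + (\<Sum>i\<in>I - J. \<beta> i))"
  have split: "Pow I = even_subsets I \<union> odd_subsets I"
    and disj: "even_subsets I \<inter> odd_subsets I = {}"
    by (auto simp: even_subsets_def odd_subsets_def)
  have fin: "finite (even_subsets I)" "finite (odd_subsets I)"
    using assms(1) split by (metis finite_Pow_iff finite_Un)+
  have pos_E: "?g J > 0" if "J \<in> even_subsets I" for J
    using that by (intro pos) (simp add: even_subsets_def)
  have pos_O: "?g J > 0" if "J \<in> odd_subsets I" for J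
    using that by (intro pos) (simp add: odd_subsets_def)
  have "(\<Prod>J\<in>even_subsets I. ?g J) > 0" "(\<Prod>J\<in>odd_subsets I. ?g J) > 0"
    by (auto intro: prod_pos pos_E pos_O)
  then have "ln ((\<Prod>J\<in>even_subsets I. ?g J) / (\<Prod>J\<in>odd_subsets I. ?g J)) =
      ln (\<Prod>J\<in>even_subsets I. ?g J) - ln (\<Prod>J\<in>odd_subsets I. ?g J)"
    by (simp add: ln_div)
  also have "ln (\<Prod>J\<in>even_subsets I. ?g J) = (\<Sum>J\<in>even_subsets I. ln (?g J))"
    by (rule ln_prod[OF fin(1)]) (use pos_E in force)
  also have "ln (\<Prod>J\<in>odd_subsets I. ?g J) = (\<Sum>J\<in>odd_subsets I. ln (?g J))"
    by (rule ln_prod[OF fin(2)]) (use pos_O in force)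
  also have "(\<Sum>J\<in>even_subsets I. ln (?g J)) - (\<Sum>J\<in>odd_subsets I. ln (?g J)) =
      (\<Sum>J\<in>even_subsets I. (-1) ^ card J * ln (?g J)) +
      (\<Sum>J\<in>odd_subsets I. (-1) ^ card J * ln (?g J))"
    by (simp add: even_subsets_def odd_subsets_def sum_negf)
  also have "\<dots> = mixed_difference I \<alpha> \<beta> (\<lambda>y. ln (g y)) x"
    unfolding mixed_difference_def split using fin disj by (simp add: sum.union_disjoint)
  finally show ?thesis .
qed

theorem theorem1:
  fixes n :: nat and I :: "nat set" and \<alpha> \<beta> :: "nat \<Rightarrow> real"
  assumes "n \<ge> 1"
    and "I = {1..n}"
    and "\<And>i. i \<in> I \<Longrightarrow> \<alpha> i \<ge> \<beta> i"
    and "\<And>i. i \<in> I \<Longrightarrow> \<beta> i \<ge> 0"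
  shows "logarithmically_completely_monotonic (\<lambda>x.
    (\<Prod>J\<in>even_subsets I. Gamma (x + (\<Sum>i\<in>J. \<alpha> i) + (\<Sum>i\<in>I - J. \<beta> i))) /
    (\<Prod>J\<in>odd_subsets I. Gamma (x + (\<Sum>i\<in>J. \<alpha> i) + (\<Sum>i\<in>I - J. \<beta> i))))"
proof -
  let ?U = "\<lambda>x. (\<Prod>J\<in>even_subsets I. Gamma (x + (\<Sum>i\<in>J. \<alpha> i) + (\<Sum>i\<in>I - J. \<beta> i))) /
    (\<Prod>J\<in>odd_subsets I. Gamma (x + (\<Sum>i\<in>J. \<alpha> i) + (\<Sum>i\<in>I - J. \<beta> i)))"
  define G where "G k y = - Polygamma k (y::real)" for k y
  have I: "finite I" "I \<noteq> {}" using assms(1,2) by auto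
  have \<alpha>_nonneg: "\<alpha> i \<ge> 0" if "i \<in> I" for i
    using assms(3,4)[OF that] by linarith
  have Gamma_pos: "Gamma (x + (\<Sum>i\<in>J. \<alpha> i) + (\<Sum>i\<in>I - J. \<beta> i)) > 0"
    if "x > 0" "J \<subseteq> I" for x J
  proof -
    have "(\<Sum>i\<in>J. \<alpha> i) \<ge> 0" "(\<Sum>i\<in>I - J. \<beta> i) \<ge> 0"
      using that(2) \<alpha>_nonneg assms(4) by (auto intro!: sum_nonneg)
    with that(1) show ?thesis by (intro Gamma_real_pos) linarith
  qed
  have U_pos: "?U x > 0" if "x > 0" for x
    by (intro divide_pos_pos prod_pos Gamma_pos that)
       (auto simp: even_subsets_def odd_subsets_def)
  have ln_Gamma_deriv: "((\<lambda>y. ln (Gamma y)) has_real_derivative Digamma x) (at x)"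
    if "x > 0" for x :: real
  proof -
    have "Gamma x \<noteq> 0" using Gamma_real_pos[OF that] by linarith
    with that show ?thesis
      by (auto intro!: derivative_eq_intros elim!: nonpos_Ints_cases)
  qed
  have ln_U_deriv:
    "((\<lambda>y. ln (?U y)) has_real_derivative mixed_difference I \<alpha> \<beta> Digamma x) (at x)"
    if "x > 0" for x
  proof -
    have "\<forall>\<^sub>F y in nhds x. y > 0"
      using eventually_nhds_in_open[of "{0<..}" x] that by simp
    then have ev: "\<forall>\<^sub>F y in nhds x. ln (?U y) = mixed_difference I \<alpha> \<beta> (\<lambda>y. ln (Gamma y)) y"
      by eventually_elim (intro ln_even_odd_quotient_eq_mixed_difference I Gamma_pos)
    have "(mixed_difference I \<alpha> \<beta> (\<lambda>y. ln (Gamma y)) has_real_derivative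
        mixed_difference I \<alpha> \<beta> Digamma x) (at x)"
      by (intro has_derivative_mixed_difference ln_Gamma_deriv \<alpha>_nonneg assms(4) that)
    with DERIV_cong_ev[OF refl ev refl] show ?thesis by (rule iffD2)
  qed
  have G_deriv: "(G k has_real_derivative G (Suc k) y) (at y)" if "y > 0" for k y
    unfolding G_def[abs_def] using that
    by (auto intro!: derivative_eq_intros elim!: nonpos_Ints_cases)
  have G_sign: "(-1) ^ k * G k y \<ge> 0" if "k \<ge> 1" "y > 0" for k y
    unfolding G_def using that by (rule Polygamma_real_alternating_sign)
  have "completely_monotonic (\<lambda>x. - deriv (\<lambda>y. ln (?U y)) x)"
  proof (rule completely_monotonic_if_derivative_family)
    show "- deriv (\<lambda>y. ln (?U y)) x = mixed_difference I \<alpha> \<beta> (G 0) x" if "x > 0" for x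
      using DERIV_imp_deriv[OF ln_U_deriv[OF that]]
      by (simp add: mixed_difference_def G_def sum_negf)
    show "(mixed_difference I \<alpha> \<beta> (G k) has_real_derivative
        mixed_difference I \<alpha> \<beta> (G (Suc k)) x) (at x)" if "x > 0" for k x
      by (intro has_derivative_mixed_difference G_deriv \<alpha>_nonneg assms(4) that)
    show "(-1) ^ k * mixed_difference I \<alpha> \<beta> (G k) x \<ge> 0" if "x > 0" for k x
      by (rule mixed_difference_sign[OF G_deriv G_sign I(1) assms(3,4) that]) (use I(2) in auto)
  qed
  moreover have "(\<lambda>y. ln (?U y)) differentiable (at x)" if "x > 0" for x
    unfolding real_differentiable_def using ln_U_deriv[OF that] by (rule exI)
  ultimately show ?thesis
    unfolding logarithmically_completely_monotonic_def using U_pos by simp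
qed

end
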